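(* Let $0<q<1$, $\nu>-1$ and $p\ge 1$. For every $f\in\mathcal{L}_{q,p,\nu}$ one has $\mathcal{F}_{q,\nu}^{2}f=f$, i.e. $\mathcal{F}_{q,\nu}(\mathcal{F}_{q,\nu}f)(x)=f(x)$ for all $x\in\mathbb{R}_q^+$.
   Context: $\mathbb{R}_q^+=\{q^n: n\in\mathbb{Z}\}$. For $a\in\mathbb{C}$, $(a;q^2)_n=\prod_{k=0}^{n-1}(1-aq^{2k})$ and $(a;q^2)_\infty=\prod_{k\ge 0}(1-aq^{2k})$. Jackson integral: $\int_0^\infty f(t)\,d_qt=(1-q)\sum_{n\in\mathbb{Z}}q^nf(q^n)$. For $1\le p<\infty$, $\mathcal{L}_{q,p,\nu}$ is the space of functions $f:\mathbb{R}_q^+\to\mathbb{R}$ with $\|f\|_{q,p,\nu}=\left(\int_0^\infty|f(x)|^px^{2\nu+1}d_qx\right)^{1/p}<\infty$. Normalized $q$-Bessel function: $j_\nu(x,q^2)=\sum_{n=0}^\infty(-1)^n\frac{q^{n(n+1)}}{(q^{2\nu+2};q^2)_n(q^2;q^2)_n}x^{2n}$. Put $c_{q,\nu}=\frac{1}{1-q}\frac{(q^{2\nu+2};q^2)_\infty}{(q^2;q^2)_\infty}$. The $q$-Bessel Fourier transform is $\mathcal{F}_{q,\nu}f(x)=c_{q,\nu}\int_0^\infty f(t)j_\nu(xt,q^2)t^{2\nu+1}d_qt$, $x\in\mathbb{R}_q^+$. *)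

theory Defs
  imports "HOL-Analysis.Analysis"
begin

definition q_poch :: "'a::comm_ring_1 \<Rightarrow> 'a \<Rightarrow> nat \<Rightarrow> 'a" where
  "q_poch a b n = (\<Prod>k<n. 1 - a * b ^ k)"

definition q_poch_inf :: "'a::real_normed_field \<Rightarrow> 'a \<Rightarrow> 'a" where
  "q_poch_inf a b = (\<Prod>k. 1 - a * b ^ k)"

definition Rq_plus :: "real \<Rightarrow> real set" where
  "Rq_plus q = range (\<lambda>n::int. q powi n)"

(* A function on Rq_plus q is represented by a total function on the reals; the
   notions below only use its values on Rq_plus q. Sums over the integers are
   unordered sums, so convergence means absolute convergence. *)

definition jackson_integrable :: "real \<Rightarrow> (real \<Rightarrow> real) \<Rightarrow> bool" where
  "jackson_integrable q f \<longleftrightarrow> (\<lambda>n::int. q powi n * f (q powi n)) summable_on UNIV"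

definition jackson_integral :: "real \<Rightarrow> (real \<Rightarrow> real) \<Rightarrow> real" where
  "jackson_integral q f = (1 - q) * (\<Sum>\<^sub>\<infinity>n::int. q powi n * f (q powi n))"

(* Finiteness of the norm is convergence of the Jackson integral of the
   nonnegative function below. *)
definition Lq_space :: "real \<Rightarrow> real \<Rightarrow> real \<Rightarrow> (real \<Rightarrow> real) set" where
  "Lq_space q p \<nu> = {f. jackson_integrable q (\<lambda>x. \<bar>f x\<bar> powr p * x powr (2 * \<nu> + 1))}"

(* This is j_nu(x, q^2): the base of the q-Pochhammer symbols is the square of
   the parameter q. *)
definition q_bessel :: "real \<Rightarrow> real \<Rightarrow> real \<Rightarrow> real" where
  "q_bessel q \<nu> x =
     (\<Sum>n. (-1) ^ n * (q ^ (n * (n + 1)) /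
            (q_poch (q powr (2 * \<nu> + 2)) (q\<^sup>2) n * q_poch (q\<^sup>2) (q\<^sup>2) n)) * x ^ (2 * n))"

definition q_bessel_const :: "real \<Rightarrow> real \<Rightarrow> real" where
  "q_bessel_const q \<nu> =
     1 / (1 - q) * (q_poch_inf (q powr (2 * \<nu> + 2)) (q\<^sup>2) / q_poch_inf (q\<^sup>2) (q\<^sup>2))"

definition q_fourier_integrand :: "real \<Rightarrow> real \<Rightarrow> (real \<Rightarrow> real) \<Rightarrow> real \<Rightarrow> real \<Rightarrow> real" where
  "q_fourier_integrand q \<nu> f x t = f t * q_bessel q \<nu> (x * t) * t powr (2 * \<nu> + 1)"

definition q_fourier :: "real \<Rightarrow> real \<Rightarrow> (real \<Rightarrow> real) \<Rightarrow> real \<Rightarrow> real" where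
  "q_fourier q \<nu> f x =
     q_bessel_const q \<nu> * jackson_integral q (q_fourier_integrand q \<nu> f x)"

(* The integral defining the transform converges at the point x; jackson_integral
   is total and returns 0 otherwise. *)
definition q_fourier_exists :: "real \<Rightarrow> real \<Rightarrow> (real \<Rightarrow> real) \<Rightarrow> real \<Rightarrow> bool" where
  "q_fourier_exists q \<nu> f x \<longleftrightarrow> jackson_integrable q (q_fourier_integrand q \<nu> f x)"

end

theory Submission
  imports Defs
begin

text \<open>
  Put \<open>Q = q\<^sup>2\<close>, \<open>a = q powr (2 * \<nu> + 2)\<close>, let \<open>\<epsilon>\<close> be the coefficients of Euler's series
  \<open>(x; Q)\<^sub>\<infinity> = \<Sum>\<^sub>i \<epsilon>\<^sub>i x\<^sup>i\<close> and \<open>e\<^sub>j = 1 / (Q; Q)\<^sub>j\<close>, both extended by \<open>0\<close> to negative indices.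
  Expanding \<open>(a Q\<^sup>n; Q)\<^sub>\<infinity>\<close> by Euler and exchanging sums, the suitably normalized values
  of the Bessel function on the lattice are \<open>h(k) = \<Sum>\<^sub>i a\<^sup>i \<epsilon>\<^sub>i e\<^sub>i\<^sub>+\<^sub>k\<close>, so their generating
  function is \<open>(a/t; Q)\<^sub>\<infinity> / (t; Q)\<^sub>\<infinity>\<close>, which is inverted by \<open>t \<mapsto> a/t\<close>. In terms of
  coefficients this is the orthogonality \<open>\<Sum>\<^sub>m a\<^sup>m h(l+m) h(n+m) = \<delta>\<^sub>l\<^sub>n a\<^sup>-\<^sup>l\<close>, a consequence of
  \<open>\<epsilon> * e = \<delta>\<close>, and the inversion formula follows by Fubini. Absolute convergence needs only
  that \<open>h\<close> is bounded (for \<open>p = 1\<close>), or that \<open>\<Sum>\<^sub>k b\<^sup>k \<bar>h(k)\<bar>\<close> is finite for every \<open>b\<close> in \<open>(0, 1)\<close>,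
  together with the pointwise bound \<open>\<bar>a\<^sup>n f(q\<^sup>n)\<bar> \<le> M b\<^sup>n\<close> for \<open>b = a powr (1 - 1 / p)\<close> (for \<open>p > 1\<close>).
\<close>


section \<open>Unordered real sums over products and over the integers\<close>

lemma summable_on_real_bound:
  fixes f g :: "'a \<Rightarrow> real"
  assumes "g summable_on A" "\<And>x. x \<in> A \<Longrightarrow> \<bar>f x\<bar> \<le> g x"
  shows "f summable_on A"
proof -
  have "(\<lambda>x. norm (f x)) summable_on A"
    by (rule Infinite_Sum.abs_summable_on_comparison_test'[OF assms(1)]) (use assms in simp)
  then show ?thesis by (subst summable_on_iff_abs_summable_on_real)
qed

lemma summable_on_real_abs:
  fixes f :: "'a \<Rightarrow> real"
  shows "f summable_on A \<Longrightarrow> (\<lambda>x. \<bar>f x\<bar>) summable_on A"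
  by (subst (asm) summable_on_iff_abs_summable_on_real) simp

lemma summable_on_mult_Times:
  fixes f :: "'a \<Rightarrow> real" and g :: "'b \<Rightarrow> real"
  assumes "f summable_on A" "g summable_on B"
  shows "(\<lambda>(x, y). f x * g y) summable_on A \<times> B"
proof -
  have "(\<lambda>x. \<bar>f x\<bar>) summable_on A" "(\<lambda>x. \<bar>g x\<bar>) summable_on B"
    by (rule summable_on_real_abs[OF assms(1)], rule summable_on_real_abs[OF assms(2)])
  then have "(\<lambda>z. norm ((\<lambda>(x, y). f x * g y) z)) summable_on A \<times> B"
    unfolding Infinite_Sum.abs_summable_on_Sigma_iff
    by (auto simp: abs_mult infsum_cmult_right' infsum_nonneg
        intro!: summable_on_cmult_right summable_on_cmult_left)
  then show ?thesis
    by (subst summable_on_iff_abs_summable_on_real)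
qed

lemma infsum_mult_Times:
  fixes f :: "'a \<Rightarrow> real" and g :: "'b \<Rightarrow> real"
  assumes "f summable_on A" "g summable_on B"
  shows "(\<Sum>\<^sub>\<infinity>(x, y)\<in>A \<times> B. f x * g y) = infsum f A * infsum g B"
  using infsum_Sigma'_banach[of "\<lambda>x y. f x * g y" A "\<lambda>_. B"] summable_on_mult_Times[OF assms]
  by (simp add: infsum_cmult_right' infsum_cmult_left')

text \<open>Coefficient sequences are indexed by all integers so that shifts are bijections; this
  passes from such a sum to a series over the naturals, where the theory of power series
  applies.\<close>

lemma has_sum_int_nat_iff:
  fixes f :: "int \<Rightarrow> real"
  assumes "\<And>k. k < 0 \<Longrightarrow> f k = 0"
  shows "(f has_sum s) UNIV \<longleftrightarrow> ((\<lambda>n. f (int n)) has_sum s) UNIV"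
proof -
  have "(f has_sum s) UNIV \<longleftrightarrow> (f has_sum s) (range int)"
  proof (rule has_sum_cong_neutral)
    fix k assume "k \<in> UNIV - range int"
    then show "f k = 0" using assms[of k] by (metis DiffD2 UNIV_I imageI linorder_not_le nonneg_int_cases)
  qed auto
  also have "\<dots> \<longleftrightarrow> ((f \<circ> int) has_sum s) UNIV"
    by (rule has_sum_reindex) (simp add: inj_on_def)
  finally show ?thesis by (simp add: o_def)
qed

lemma summable_on_int_nat_iff:
  fixes f :: "int \<Rightarrow> real"
  assumes "\<And>k. k < 0 \<Longrightarrow> f k = 0"
  shows "f summable_on UNIV \<longleftrightarrow> (\<lambda>n. f (int n)) summable_on UNIV"
  using has_sum_int_nat_iff[OF assms] by (auto simp: summable_on_def)

lemma bij_int_shift: "bij (\<lambda>k::int. d + k)" "bij (\<lambda>k::int. k - d)"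
  by (rule bij_betw_byWitness[of _ "\<lambda>k. k - d"]; auto; fail
    | rule bij_betw_byWitness[of _ "\<lambda>k. k + d"]; auto; fail)+

section \<open>Pochhammer symbols and infinite products\<close>

lemma q_poch_Suc: "q_poch x b (Suc n) = q_poch x b n * (1 - x * b ^ n)"
  by (simp add: q_poch_def)

lemma q_poch_0 [simp]: "q_poch x b 0 = 1"
  by (simp add: q_poch_def)

text \<open>The zero extension makes the recurrences below hold at every integer, so sums can be
  shifted without boundary terms.\<close>

definition euler_coeff :: "real \<Rightarrow> int \<Rightarrow> real" where
  "euler_coeff Q k =
     (if k < 0 then 0 else (- 1) ^ nat k * Q ^ (nat k choose 2) / q_poch Q Q (nat k))"

definition inv_q_poch :: "real \<Rightarrow> int \<Rightarrow> real" where
  "inv_q_poch Q k = (if k < 0 then 0 else 1 / q_poch Q Q (nat k))"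

lemma euler_coeff_neg [simp]: "k < 0 \<Longrightarrow> euler_coeff Q k = 0"
  and inv_q_poch_neg [simp]: "k < 0 \<Longrightarrow> inv_q_poch Q k = 0"
  and euler_coeff_0 [simp]: "euler_coeff Q 0 = 1"
  and inv_q_poch_0 [simp]: "inv_q_poch Q 0 = 1"
  by (simp_all add: euler_coeff_def inv_q_poch_def numeral_2_eq_2)

lemma int_neg_zero_Suc_cases:
  obtains "k < 0" | "k = 0" | n where "k = int (Suc n)"
  by (metis linorder_neqE_linordered_idom gr0_implies_Suc pos_int_cases)

text \<open>
  This is \<open>q_bessel_const q \<nu> * (1 - q) * q_bessel q \<nu> (q powi k)\<close> for
  \<open>Q = q\<^sup>2\<close> and \<open>a = q powr (2 * \<nu> + 2)\<close>; see \<open>q_bessel_eq_bessel_seq\<close>.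
\<close>
definition bessel_seq :: "real \<Rightarrow> real \<Rightarrow> int \<Rightarrow> real" where
  "bessel_seq Q a k = (\<Sum>\<^sub>\<infinity>i. euler_coeff Q i * a powi i * inv_q_poch Q (i + k))"

locale q_base =
  fixes Q :: real
  assumes Q_pos: "0 < Q" and Q_less_1: "Q < 1"
begin

lemma mult_power_less_1:
  assumes "0 < x" "x < 1"
  shows "x * Q ^ k < 1"
proof -
  have "x * Q ^ k \<le> x * 1"
    using assms Q_pos Q_less_1 by (intro mult_left_mono power_le_one) auto
  also have "\<dots> < 1" using assms by simp
  finally show ?thesis .
qed

lemma q_poch_pos_of_less_1: "0 < x \<Longrightarrow> x < 1 \<Longrightarrow> q_poch x Q n > 0"
  by (simp add: q_poch_def mult_power_less_1 prod_pos)

lemmas q_poch_pos = q_poch_pos_of_less_1[OF Q_pos Q_less_1]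

lemma convergent_prod_q_poch: "convergent_prod (\<lambda>k. 1 - x * Q ^ k)"
proof (intro abs_convergent_prod_imp_convergent_prod summable_imp_abs_convergent_prod)
  show "summable (\<lambda>k. norm (1 - x * Q ^ k - 1))"
    using Q_pos Q_less_1 by (simp add: abs_mult summable_mult summable_geometric)
qed

lemma q_poch_LIMSEQ: "q_poch x Q \<longlonglongrightarrow> q_poch_inf x Q"
proof -
  have "(\<lambda>n. q_poch x Q (Suc n)) \<longlonglongrightarrow> q_poch_inf x Q"
    using convergent_prod_LIMSEQ[OF convergent_prod_q_poch[of x]]
    by (simp add: q_poch_def q_poch_inf_def lessThan_Suc_atMost)
  then show ?thesis by (rule LIMSEQ_imp_Suc)
qed

lemma q_poch_inf_split: "q_poch_inf x Q = q_poch x Q n * q_poch_inf (x * Q ^ n) Q"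
proof -
  have "q_poch x Q (m + n) = q_poch x Q n * q_poch (x * Q ^ n) Q m" for m
    by (induction m) (simp_all add: q_poch_Suc power_add mult_ac)
  then have "(\<lambda>m. q_poch x Q n * q_poch (x * Q ^ n) Q m) \<longlonglongrightarrow> q_poch_inf x Q"
    using LIMSEQ_ignore_initial_segment[OF q_poch_LIMSEQ[of x], of n] by simp
  moreover have "(\<lambda>m. q_poch x Q n * q_poch (x * Q ^ n) Q m)
      \<longlonglongrightarrow> q_poch x Q n * q_poch_inf (x * Q ^ n) Q"
    by (intro tendsto_intros q_poch_LIMSEQ)
  ultimately show ?thesis by (rule LIMSEQ_unique)
qed

lemma q_poch_inf_pos_of_less_1:
  assumes "0 < x" "x < 1"
  shows "q_poch_inf x Q > 0"
proof -
  have "1 - x * Q ^ k \<noteq> 0" for k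
    using mult_power_less_1[OF assms, of k] by simp
  then have "q_poch_inf x Q \<noteq> 0"
    unfolding q_poch_inf_def by (intro prodinf_nonzero convergent_prod_q_poch)
  moreover have "q_poch_inf x Q \<ge> 0"
    using q_poch_pos_of_less_1[OF assms]
    by (intro LIMSEQ_le_const[OF q_poch_LIMSEQ]) (auto intro: less_imp_le)
  ultimately show ?thesis by simp
qed

lemmas q_poch_inf_pos = q_poch_inf_pos_of_less_1[OF Q_pos Q_less_1]

text \<open>Every factor lies in (0, 1), so the partial products decrease to their limit. This is
  the source of the uniform bound on \<open>inv_q_poch\<close>.\<close>

lemma q_poch_inf_le: "q_poch_inf Q Q \<le> q_poch Q Q n"
proof (rule decseq_ge[OF _ q_poch_LIMSEQ])
  show "decseq (q_poch Q Q)"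
    using Q_pos q_poch_pos
    by (intro decseq_SucI) (auto simp: q_poch_Suc intro!: mult_left_le less_imp_le)
qed

lemma inv_q_poch_nonneg: "inv_q_poch Q k \<ge> 0"
  using q_poch_pos by (simp add: inv_q_poch_def less_imp_le)

lemma inv_q_poch_le: "inv_q_poch Q k \<le> 1 / q_poch_inf Q Q"
  using q_poch_inf_pos q_poch_inf_le q_poch_pos
  by (simp add: inv_q_poch_def frac_le)

section \<open>Recurrences and Euler's series\<close>

text \<open>This is F(x) = (1 - x) F(Q x) read off at x^k, for F(x) = (x; Q)_inf. At
  \<open>k = 0\<close> both sides vanish: the left through its factor, the right through the zero
  extension.\<close>

lemma euler_coeff_rec: "(1 - Q powi k) * euler_coeff Q k = - (Q powi (k - 1) * euler_coeff Q (k - 1))"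
proof (cases k rule: int_neg_zero_Suc_cases)
  case (3 n)
  have "1 - Q * Q ^ n \<noteq> 0"
    using power_Suc_less_one[OF Q_pos Q_less_1, of n] by simp
  moreover have "Suc n choose 2 = (n choose 2) + n"
    by (simp add: numeral_2_eq_2)
  moreover have "k - 1 = int n" "nat k = Suc n" "\<not> k < 0" "Q powi k = Q * Q ^ n"
    using 3 by (simp_all, simp only: power_int_of_nat power_Suc flip: of_nat_Suc)
  ultimately show ?thesis
    using q_poch_pos[of n] by (simp add: euler_coeff_def q_poch_Suc power_add)
qed auto

text \<open>The counterpart for the reciprocal G = 1 / F, namely G(Q x) = (1 - x) G(x), again valid
  at every integer.\<close>

lemma inv_q_poch_rec: "(1 - Q powi k) * inv_q_poch Q k = inv_q_poch Q (k - 1)"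
proof (cases k rule: int_neg_zero_Suc_cases)
  case (3 n)
  have "1 - Q * Q ^ n \<noteq> 0"
    using power_Suc_less_one[OF Q_pos Q_less_1, of n] by simp
  moreover have "k - 1 = int n" "nat k = Suc n" "\<not> k < 0" "Q powi k = Q * Q ^ n"
    using 3 by (simp_all, simp only: power_int_of_nat power_Suc flip: of_nat_Suc)
  ultimately show ?thesis
    using q_poch_pos[of n] by (simp add: inv_q_poch_def q_poch_Suc)
qed auto

lemma euler_coeff_rec_Suc:
  "(1 - Q ^ Suc n) * euler_coeff Q (int (Suc n)) = - (Q ^ n * euler_coeff Q (int n))"
  using euler_coeff_rec[of "int (Suc n)"] by (simp add: power_int_def nat_add_distrib)

lemma euler_coeff_Suc:
  "euler_coeff Q (int (Suc n)) = - (Q ^ n / (1 - Q ^ Suc n)) * euler_coeff Q (int n)"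
proof -
  have "1 - Q ^ Suc n \<noteq> 0"
    using power_Suc_less_one[OF Q_pos Q_less_1, of n] by simp
  then show ?thesis
    using euler_coeff_rec_Suc[of n] by (simp add: field_simps del: of_nat_Suc power_Suc)
qed

text \<open>The ratio of consecutive terms is at most
  \<open>\<bar>x\<bar> / (1 - Q) * Q ^ n\<close>, which tends to 0. The series is therefore entire,
  and \<open>x\<close> may be any real number.\<close>

lemma summable_euler_coeff: "summable (\<lambda>n. norm (euler_coeff Q (int n) * x ^ n))"
proof -
  have "(\<lambda>n. \<bar>x\<bar> / (1 - Q) * Q ^ n) \<longlonglongrightarrow> 0"
    using LIMSEQ_realpow_zero[of Q] Q_pos Q_less_1 by (auto intro!: tendsto_eq_intros)
  then have "eventually (\<lambda>n. \<bar>x\<bar> / (1 - Q) * Q ^ n < 1/2) sequentially"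
    by (rule order_tendstoD) simp
  then obtain N where N: "\<And>n. n \<ge> N \<Longrightarrow> \<bar>x\<bar> / (1 - Q) * Q ^ n < 1/2"
    by (auto simp: eventually_sequentially)
  show ?thesis
  proof (rule summable_ratio_test[of "1/2" N])
    fix n assume "n \<ge> N"
    have "Q ^ n / (1 - Q ^ Suc n) \<le> Q ^ n / (1 - Q)"
      using Q_pos Q_less_1 power_Suc_less_one[OF Q_pos Q_less_1, of n] power_decreasing[of 1 "Suc n" Q]
      by (intro divide_left_mono) auto
    then have "\<bar>x\<bar> * (Q ^ n / (1 - Q ^ Suc n)) \<le> \<bar>x\<bar> * (Q ^ n / (1 - Q))"
      by (rule mult_left_mono) simp
    also have "\<dots> \<le> 1/2" using N[OF \<open>n \<ge> N\<close>] by simp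
    finally have "\<bar>x\<bar> * (Q ^ n / (1 - Q ^ Suc n)) * \<bar>euler_coeff Q (int n) * x ^ n\<bar> \<le> 1/2 * \<bar>euler_coeff Q (int n) * x ^ n\<bar>"
      by (rule mult_right_mono) simp
    moreover have "\<bar>Q ^ n / (1 - Q ^ Suc n)\<bar> = Q ^ n / (1 - Q ^ Suc n)"
      using Q_pos power_Suc_less_one[OF Q_pos Q_less_1, of n] by simp
    moreover have "\<bar>euler_coeff Q (int (Suc n)) * x ^ Suc n\<bar> =
        \<bar>x\<bar> * \<bar>Q ^ n / (1 - Q ^ Suc n)\<bar> * \<bar>euler_coeff Q (int n) * x ^ n\<bar>"
      unfolding euler_coeff_Suc by (simp only: abs_mult abs_minus_cancel power_Suc mult_ac)
    ultimately show "norm (norm (euler_coeff Q (int (Suc n)) * x ^ Suc n)) \<le> 1/2 * norm (norm (euler_coeff Q (int n) * x ^ n))"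
      unfolding real_norm_def abs_abs by (simp only:)
  qed auto
qed

lemma summable_on_euler_coeff: "(\<lambda>k. \<bar>euler_coeff Q k\<bar> * \<bar>x powi k\<bar>) summable_on UNIV"
  using norm_summable_imp_summable_on[of "\<lambda>n. \<bar>euler_coeff Q (int n) * x ^ n\<bar>"] summable_euler_coeff[of x]
  by (subst summable_on_int_nat_iff) (auto simp: abs_mult power_abs)

text \<open>Both sides are continuous at \<open>0\<close> and satisfy \<open>F y = (1 - y) * F (y * Q)\<close>.\<close>
lemma euler_sums: "(\<lambda>n. euler_coeff Q (int n) * x ^ n) sums q_poch_inf x Q"
proof -
  define c where "c n = euler_coeff Q (int n)" for n
  define F where "F y = (\<Sum>n. c n * y ^ n)" for y
  have smm: "summable (\<lambda>n. c n * y ^ n)" for y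
    using summable_euler_coeff[of y] unfolding c_def by (rule summable_norm_cancel)
  have F0: "F y = c 0 + (\<Sum>n. c (Suc n) * y ^ Suc n)" for y
    using suminf_split_head[OF smm[of y]] by (simp add: F_def)
  have c: "c (Suc n) = Q ^ Suc n * c (Suc n) - Q ^ n * c n" for n
    using euler_coeff_rec_Suc[of n] unfolding c_def left_diff_distrib by linarith
  have step: "F y = (1 - y) * F (y * Q)" for y
  proof -
    have 1: "summable (\<lambda>n. c (Suc n) * (y * Q) ^ Suc n)"
      using smm[of "y * Q"] by (subst summable_Suc_iff)
    have "(\<Sum>n. c (Suc n) * y ^ Suc n) = (\<Sum>n. c (Suc n) * (y * Q) ^ Suc n - y * (c n * (y * Q) ^ n))"
    proof (rule arg_cong[of _ _ suminf], rule ext)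
      fix n
      have "c (Suc n) * y ^ Suc n = (Q ^ Suc n * c (Suc n) - Q ^ n * c n) * y ^ Suc n"
        by (subst c) (rule refl)
      then show "c (Suc n) * y ^ Suc n = c (Suc n) * (y * Q) ^ Suc n - y * (c n * (y * Q) ^ n)"
        by (simp only: power_mult_distrib left_diff_distrib right_diff_distrib power_Suc mult_ac)
    qed
    also have "\<dots> = (\<Sum>n. c (Suc n) * (y * Q) ^ Suc n) - y * F (y * Q)"
      using suminf_diff[OF 1 summable_mult[OF smm[of "y * Q"], of y]] suminf_mult[OF smm[of "y * Q"], of y]
      by (simp add: F_def)
    finally show ?thesis
      using F0[of y] F0[of "y * Q"] unfolding left_diff_distrib by linarith
  qed
  \<comment> \<open>Iteration moves the argument to \<open>x * Q ^ n\<close>, which tends to 0, so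
    continuity of \<open>F\<close> at 0 determines \<open>F x\<close>.\<close>
  have iter: "F x = q_poch x Q n * F (x * Q ^ n)" for n
  proof (induction n)
    case (Suc n)
    then show ?case using step[of "x * Q ^ n"] by (simp add: q_poch_Suc mult_ac)
  qed simp
  have "(F \<longlongrightarrow> c 0) (at 0)"
    by (rule powser_limit_0[of 1]) (use smm in \<open>auto simp: F_def\<close>)
  moreover have "F 0 = c 0" by (subst F0) simp
  ultimately have "isCont F 0" by (simp add: isCont_def)
  moreover have "(\<lambda>n. x * Q ^ n) \<longlonglongrightarrow> 0"
    using LIMSEQ_realpow_zero[of Q] Q_pos Q_less_1 by (auto intro!: tendsto_eq_intros)
  ultimately have "(\<lambda>n. F (x * Q ^ n)) \<longlonglongrightarrow> F 0" by (rule isCont_tendsto_compose)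
  then have "(\<lambda>n. q_poch x Q n * F (x * Q ^ n)) \<longlonglongrightarrow> q_poch_inf x Q * F 0"
    by (intro tendsto_mult q_poch_LIMSEQ)
  then have "(\<lambda>n::nat. F x) \<longlonglongrightarrow> q_poch_inf x Q * F 0" by (simp flip: iter)
  then have "F x = q_poch_inf x Q * F 0" by (simp add: LIMSEQ_const_iff)
  then have "F x = q_poch_inf x Q" using \<open>F 0 = c 0\<close> by (simp add: c_def)
  then show ?thesis using smm[of x] by (simp add: sums_iff F_def c_def)
qed

lemma euler_has_sum_nat: "((\<lambda>n. euler_coeff Q (int n) * x ^ n) has_sum q_poch_inf x Q) UNIV"
  using norm_summable_imp_has_sum[OF summable_euler_coeff euler_sums] .

lemma euler_has_sum: "((\<lambda>k. euler_coeff Q k * x powi k) has_sum q_poch_inf x Q) UNIV"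
  using euler_has_sum_nat[of x] by (subst has_sum_int_nat_iff) auto

section \<open>The convolution identity\<close>

lemma summable_on_euler_conv: "(\<lambda>i. euler_coeff Q i * inv_q_poch Q (N - i)) summable_on UNIV"
proof (rule summable_on_real_bound)
  \<comment> \<open>The factor \<open>\<bar>1 powi i\<bar>\<close> equals 1 and is kept so that the
    bound is an instance of \<open>summable_on_euler_coeff\<close>.\<close>
  show "(\<lambda>i. \<bar>euler_coeff Q i\<bar> * \<bar>1 powi i\<bar> * (1 / q_poch_inf Q Q)) summable_on UNIV"
    by (intro summable_on_cmult_left summable_on_euler_coeff)
  show "\<bar>euler_coeff Q i * inv_q_poch Q (N - i)\<bar> \<le> \<bar>euler_coeff Q i\<bar> * \<bar>1 powi i\<bar> * (1 / q_poch_inf Q Q)" for i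
    using mult_left_mono[OF inv_q_poch_le[of "N - i"], of "\<bar>euler_coeff Q i\<bar>"] inv_q_poch_nonneg[of "N - i"]
    by (simp add: abs_mult)
qed

text \<open>Coefficient form of (x; Q)_inf * (1 / (x; Q)_inf) = 1, derived from the two recurrences
  alone.\<close>

lemma euler_conv: "(\<Sum>\<^sub>\<infinity>i. euler_coeff Q i * inv_q_poch Q (N - i)) = (if N = 0 then 1 else 0)"
proof -
  consider "N < 0" | "N = 0" | "N > 0" by linarith
  then show ?thesis
  proof cases
    case 1
    then have "euler_coeff Q i * inv_q_poch Q (N - i) = 0" for i
      by (cases "i < 0") auto
    then show ?thesis using 1 by (simp only:) simp
  next
    case 2
    have "(\<Sum>\<^sub>\<infinity>i. euler_coeff Q i * inv_q_poch Q (N - i)) = (\<Sum>\<^sub>\<infinity>i\<in>{0}. euler_coeff Q i * inv_q_poch Q (N - i))"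
    proof (rule infsum_cong_neutral)
      show "euler_coeff Q i * inv_q_poch Q (N - i) = 0" if "i \<in> UNIV - {0}" for i
        using that 2 by (cases "i < 0") auto
    qed auto
    then show ?thesis using 2 by simp
  next
    case 3
    \<comment> \<open>Splitting \<open>1 - Q\<^sup>N = (1 - Q\<^sup>i) + Q\<^sup>i (1 - Q\<^sup>N\<^sup>-\<^sup>i)\<close> makes the sum telescope.\<close>
    define g where "g i = Q powi i * (euler_coeff Q i * inv_q_poch Q (N - 1 - i))" for i
    \<comment> \<open>Summability of \<open>g\<close> allows the sum of differences to be split; the
      shifted sum then cancels.\<close>
    have g: "g summable_on UNIV"
    proof (rule summable_on_real_bound)
      show "(\<lambda>i. \<bar>euler_coeff Q i * inv_q_poch Q (N - 1 - i)\<bar>) summable_on UNIV"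
        by (rule summable_on_real_abs[OF summable_on_euler_conv])
      fix i
      show "\<bar>g i\<bar> \<le> \<bar>euler_coeff Q i * inv_q_poch Q (N - 1 - i)\<bar>"
      proof (cases "i < 0")
        case False
        then have "Q powi i \<le> 1" "Q powi i \<ge> 0"
          using Q_pos Q_less_1 by (auto simp: power_int_def power_le_one)
        then show ?thesis by (simp add: g_def abs_mult mult_left_le_one_le)
      qed (simp add: g_def)
    qed
    have "(1 - Q powi N) * (euler_coeff Q i * inv_q_poch Q (N - i)) = g i - g (i - 1)" for i
    proof -
      have "Q powi N = Q powi i * Q powi (N - i)"
        using Q_pos by (simp flip: power_int_add)
      then have "(1 - Q powi N) * (euler_coeff Q i * inv_q_poch Q (N - i)) =
          ((1 - Q powi i) * euler_coeff Q i) * inv_q_poch Q (N - i)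
          + Q powi i * euler_coeff Q i * ((1 - Q powi (N - i)) * inv_q_poch Q (N - i))"
        by (simp add: algebra_simps)
      then show ?thesis
        unfolding euler_coeff_rec inv_q_poch_rec by (simp add: g_def algebra_simps)
    qed
    then have "(1 - Q powi N) * (\<Sum>\<^sub>\<infinity>i. euler_coeff Q i * inv_q_poch Q (N - i)) = (\<Sum>\<^sub>\<infinity>i. g i - g (i - 1))"
      by (subst infsum_cmult_right'[symmetric]) simp
    also have "\<dots> = infsum g UNIV - (\<Sum>\<^sub>\<infinity>i. g (i - 1))"
      using infsum_add[of g UNIV "\<lambda>i. - g (i - 1)"] g summable_on_reindex_bij_betw[OF bij_int_shift(2), of g 1]
      by (auto simp: infsum_uminus summable_on_uminus)
    also have "\<dots> = 0"
      using infsum_reindex_bij_betw[OF bij_int_shift(2), of g 1] by simp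
    finally have "Q powi N = 1 \<or> (\<Sum>\<^sub>\<infinity>i. euler_coeff Q i * inv_q_poch Q (N - i)) = 0" by simp
    moreover have "Q powi N < 1"
      using 3 Q_pos Q_less_1 by (auto simp: power_int_def power_less_one_iff)
    ultimately show ?thesis using 3 by simp
  qed
qed


section \<open>Bounds and summability of the Bessel sequence\<close>

lemma summable_on_inv_q_poch:
  assumes "0 < b" "b < 1"
  shows "(\<lambda>j. b powi j * inv_q_poch Q j) summable_on UNIV"
proof -
  have "(\<lambda>n. b ^ n * (1 / q_poch_inf Q Q)) summable_on UNIV"
    using assms by (intro summable_on_cmult_left norm_summable_imp_summable_on) (simp add: summable_geometric)
  then have "(\<lambda>n. b ^ n * inv_q_poch Q (int n)) summable_on UNIV"
    using assms inv_q_poch_le inv_q_poch_nonneg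
    by (elim summable_on_real_bound) (auto simp: abs_mult simp del: times_divide_eq_right intro!: mult_left_mono)
  then show ?thesis by (subst summable_on_int_nat_iff) auto
qed

text \<open>The majorant is free of \<open>j\<close>, so a single summable bound serves every shift
  \<open>k\<close>; boundedness of \<open>bessel_seq\<close> follows.\<close>

lemma bessel_seq_term_le:
  "\<bar>euler_coeff Q i * a powi i * inv_q_poch Q j\<bar> \<le> \<bar>euler_coeff Q i\<bar> * \<bar>a powi i\<bar> * (1 / q_poch_inf Q Q)"
  unfolding abs_mult
  using inv_q_poch_le[of j] inv_q_poch_nonneg[of j] by (intro mult_left_mono) auto

lemma summable_on_bessel_seq_term:
  "(\<lambda>i. euler_coeff Q i * a powi i * inv_q_poch Q (i + k)) summable_on UNIV"
  by (rule summable_on_real_bound[OF _ bessel_seq_term_le])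
    (intro summable_on_cmult_left summable_on_euler_coeff)

lemma abs_bessel_seq_le:
  "\<bar>bessel_seq Q a k\<bar> \<le> (\<Sum>\<^sub>\<infinity>i. \<bar>euler_coeff Q i * a powi i * inv_q_poch Q (i + k)\<bar>)"
  unfolding bessel_seq_def
  using norm_infsum_bound[of "\<lambda>i. euler_coeff Q i * a powi i * inv_q_poch Q (i + k)" UNIV]
    summable_on_real_abs[OF summable_on_bessel_seq_term[of a k]] by simp

lemma bessel_seq_bounded: "\<exists>B. \<forall>k. \<bar>bessel_seq Q a k\<bar> \<le> B"
proof (intro exI allI)
  fix k
  show "\<bar>bessel_seq Q a k\<bar> \<le> (\<Sum>\<^sub>\<infinity>i. \<bar>euler_coeff Q i\<bar> * \<bar>a powi i\<bar> * (1 / q_poch_inf Q Q))"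
    by (rule order_trans[OF abs_bessel_seq_le], intro infsum_mono bessel_seq_term_le
        summable_on_real_abs summable_on_bessel_seq_term summable_on_cmult_left summable_on_euler_coeff)
qed

text \<open>With \<open>j = i + k\<close> the weight \<open>b powi k\<close> splits as
  \<open>b powi (- i) * b powi j\<close>, so the double sum factors. The factor in \<open>i\<close>
  converges since Euler's series is entire, the factor in \<open>j\<close> since
  \<open>b < 1\<close>.\<close>

lemma summable_on_bessel_seq:
  assumes "0 < b" "b < 1"
  shows "(\<lambda>k. b powi k * \<bar>bessel_seq Q a k\<bar>) summable_on UNIV"
proof -
  define G where "G = (\<lambda>(i, j). (\<bar>euler_coeff Q i\<bar> * \<bar>(a / b) powi i\<bar>) * (b powi j * inv_q_poch Q j))"
  have bij: "bij_betw (\<lambda>(k, i). (i, i + k)) (UNIV \<times> UNIV) (UNIV \<times> UNIV :: (int \<times> int) set)"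
    by (rule bij_betw_byWitness[of _ "\<lambda>(i, j). (j - i, i)"]) auto
  have "G summable_on UNIV \<times> UNIV"
    unfolding G_def
    by (rule summable_on_mult_Times) (intro summable_on_euler_coeff summable_on_inv_q_poch assms)+
  then have "(\<lambda>(k, i). G (i, i + k)) summable_on UNIV \<times> UNIV"
    using summable_on_reindex_bij_betw[OF bij, of G] by (simp add: case_prod_unfold)
  moreover have "G (i, i + k) = b powi k * \<bar>euler_coeff Q i * a powi i * inv_q_poch Q (i + k)\<bar>" for i k
    using assms inv_q_poch_nonneg[of "i + k"]
    by (simp add: G_def abs_mult power_int_divide_distrib power_int_add)
  ultimately have "(\<lambda>(k, i). b powi k * \<bar>euler_coeff Q i * a powi i * inv_q_poch Q (i + k)\<bar>) summable_on UNIV \<times> UNIV"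
    by simp
  then have "(\<lambda>k. \<Sum>\<^sub>\<infinity>i. b powi k * \<bar>euler_coeff Q i * a powi i * inv_q_poch Q (i + k)\<bar>) summable_on UNIV"
    using summable_on_Sigma_banach[of "\<lambda>k i. b powi k * \<bar>euler_coeff Q i * a powi i * inv_q_poch Q (i + k)\<bar>" UNIV "\<lambda>_. UNIV"]
    by simp
  then show ?thesis
  proof (rule summable_on_real_bound)
    fix k
    show "\<bar>b powi k * \<bar>bessel_seq Q a k\<bar>\<bar> \<le> (\<Sum>\<^sub>\<infinity>i. b powi k * \<bar>euler_coeff Q i * a powi i * inv_q_poch Q (i + k)\<bar>)"
      using abs_bessel_seq_le[of a k] assms(1)
      by (simp only: infsum_cmult_right') (simp add: abs_mult mult_left_mono)
  qed
qed

lemma summable_on_bessel_seq_shift: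
  assumes "0 < b" "b < 1"
  shows "(\<lambda>m. b powi m * \<bar>bessel_seq Q a (l + m)\<bar>) summable_on UNIV"
proof -
  have "(\<lambda>m. b powi (l + m) * \<bar>bessel_seq Q a (l + m)\<bar>) summable_on UNIV"
    using summable_on_bessel_seq[OF assms, of a]
      summable_on_reindex_bij_betw[OF bij_int_shift(1), of "\<lambda>k. b powi k * \<bar>bessel_seq Q a k\<bar>" l]
    by simp
  then have "(\<lambda>m. b powi (- l) * (b powi (l + m) * \<bar>bessel_seq Q a (l + m)\<bar>)) summable_on UNIV"
    by (rule summable_on_cmult_right)
  moreover have "b powi (- l) * (b powi (l + m) * c) = b powi m * c" for m c
    using assms by (simp add: power_int_add power_int_minus)
  ultimately show ?thesis by simp
qed

section \<open>Orthogonality of the shifted Bessel sequences\<close>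

text \<open>After the change of variables each Euler coefficient meets the \<open>inv_q_poch\<close>
  of the other Bessel factor. The two convolutions are then deltas at \<open>N + n - l = 0\<close>
  and at \<open>N = 0\<close>, so only \<open>N = 0\<close> with \<open>l = n\<close> survives, with
  weight \<open>a powi (- l)\<close>.\<close>

lemma bessel_seq_orthogonal:
  assumes "0 < a" "a < 1"
  shows "(\<Sum>\<^sub>\<infinity>m. a powi m * (bessel_seq Q a (l + m) * bessel_seq Q a (n + m)))
    = (if l = n then a powi (- l) else 0)"
proof -
  define t where "t k i = euler_coeff Q i * a powi i * inv_q_poch Q (i + k)" for k i
  define F where "F = (\<lambda>(m, i, i'). a powi m * (t (l + m) i * t (n + m) i'))"
  define G where "G = (\<lambda>(N, i, i'). a powi (N - l) * (euler_coeff Q i * inv_q_poch Q (N + n - l - i)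
      * (euler_coeff Q i' * inv_q_poch Q (N - i'))))"
  \<comment> \<open>The cutoff removes negative \<open>N\<close>, where \<open>a powi N\<close> is
    unbounded. It is harmless: for \<open>N < 0\<close> either \<open>i' < 0\<close> or
    \<open>N - i' < 0\<close>, so \<open>G\<close> vanishes there.\<close>
  define w where "w N = (if N < 0 then 0 else a powi N)" for N :: int
  define M where "M = 1 / q_poch_inf Q Q"
  define R where "R = (\<lambda>(i, i'). (\<bar>euler_coeff Q i\<bar> * \<bar>1 powi i\<bar>) * (\<bar>euler_coeff Q i'\<bar> * \<bar>1 powi i'\<bar>))"
  define S where "S = (\<lambda>(N, p). (w N * (a powi (- l) * M * M)) * R p)"
  \<comment> \<open>With \<open>N = m + l + i + i'\<close> the triple sum decouples into two convolutions \<open>\<epsilon> * e\<close>.\<close>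
  have bij: "bij_betw (\<lambda>(m, i, i'). (m + l + i + i', i, i')) (UNIV \<times> UNIV \<times> UNIV)
      (UNIV \<times> UNIV \<times> UNIV :: (int \<times> int \<times> int) set)"
    by (rule bij_betw_byWitness[of _ "\<lambda>(N, i, i'). (N - l - i - i', i, i')"]) auto
  have "w summable_on UNIV"
    by (subst summable_on_int_nat_iff)
      (use assms in \<open>auto simp: w_def intro!: norm_summable_imp_summable_on summable_geometric\<close>)
  then have "S summable_on UNIV \<times> UNIV \<times> UNIV"
    unfolding S_def R_def UNIV_Times_UNIV
    by (intro summable_on_mult_Times[where A = UNIV and B = UNIV, unfolded UNIV_Times_UNIV]
        summable_on_cmult_left summable_on_euler_coeff)
  then have G: "G summable_on UNIV \<times> UNIV \<times> UNIV"
  proof (rule summable_on_real_bound, clarify)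
    fix N i i'
    have e: "\<bar>inv_q_poch Q j\<bar> \<le> M" for j
      using inv_q_poch_le[of j] inv_q_poch_nonneg[of j] by (simp add: M_def)
    have M: "M \<ge> 0" using e[of 0] by simp
    show "\<bar>G (N, i, i')\<bar> \<le> S (N, i, i')"
    proof (cases "N < 0")
      case True
      then have "euler_coeff Q i' * inv_q_poch Q (N - i') = 0"
        by (cases "i' < 0") auto
      then show ?thesis using True by (simp add: G_def S_def R_def w_def)
    next
      case False
      have "\<bar>euler_coeff Q i * inv_q_poch Q (N + n - l - i)\<bar> \<le> \<bar>euler_coeff Q i\<bar> * M"
        "\<bar>euler_coeff Q i' * inv_q_poch Q (N - i')\<bar> \<le> \<bar>euler_coeff Q i'\<bar> * M"
        unfolding abs_mult by (intro mult_left_mono e; simp)+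
      then have "\<bar>euler_coeff Q i * inv_q_poch Q (N + n - l - i) * (euler_coeff Q i' * inv_q_poch Q (N - i'))\<bar>
          \<le> (\<bar>euler_coeff Q i\<bar> * M) * (\<bar>euler_coeff Q i'\<bar> * M)"
        unfolding abs_mult[of "_ * inv_q_poch Q (N + n - l - i)"] using M by (intro mult_mono) auto
      then have "\<bar>G (N, i, i')\<bar> \<le> a powi (N - l) * ((\<bar>euler_coeff Q i\<bar> * M) * (\<bar>euler_coeff Q i'\<bar> * M))"
        unfolding G_def prod.case abs_mult[of "a powi _"] using assms by simp
      also have "\<dots> = S (N, i, i')"
        using False assms by (simp add: S_def R_def w_def power_int_diff power_int_minus field_simps)
      finally show ?thesis .
    qed
  qed
  have FG: "F z = G ((\<lambda>(m, i, i'). (m + l + i + i', i, i')) z)" for z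
    using assms by (cases z) (simp add: F_def G_def t_def power_int_add algebra_simps)
  have F: "F summable_on UNIV \<times> UNIV \<times> UNIV"
    using G unfolding FG summable_on_reindex_bij_betw[OF bij] .
  have "(\<Sum>\<^sub>\<infinity>m. a powi m * (bessel_seq Q a (l + m) * bessel_seq Q a (n + m)))
      = (\<Sum>\<^sub>\<infinity>m. \<Sum>\<^sub>\<infinity>p\<in>UNIV \<times> UNIV. F (m, p))"
    unfolding bessel_seq_def F_def t_def prod.case
    by (subst infsum_mult_Times[symmetric])
      (auto simp: summable_on_bessel_seq_term infsum_cmult_right' case_prod_unfold)
  also have "\<dots> = infsum F (UNIV \<times> UNIV \<times> UNIV)"
    using F by (rule infsum_Sigma_banach)
  also have "\<dots> = infsum G (UNIV \<times> UNIV \<times> UNIV)"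
    unfolding FG by (rule infsum_reindex_bij_betw[OF bij])
  also have "\<dots> = (\<Sum>\<^sub>\<infinity>N. \<Sum>\<^sub>\<infinity>p\<in>UNIV \<times> UNIV. G (N, p))"
    using G by (rule infsum_Sigma_banach[symmetric])
  also have "\<dots> = (\<Sum>\<^sub>\<infinity>N::int. if N = 0 then (if l = n then a powi (- l) else 0) else 0)"
  proof (rule infsum_cong)
    fix N :: int
    have "(\<Sum>\<^sub>\<infinity>p\<in>UNIV \<times> UNIV. G (N, p)) =
        a powi (N - l) * ((\<Sum>\<^sub>\<infinity>i. euler_coeff Q i * inv_q_poch Q (N + n - l - i)) * (\<Sum>\<^sub>\<infinity>i'. euler_coeff Q i' * inv_q_poch Q (N - i')))"
      unfolding G_def prod.case
      by (subst infsum_mult_Times[symmetric])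
        (auto simp: summable_on_euler_conv infsum_cmult_right' case_prod_unfold)
    then show "(\<Sum>\<^sub>\<infinity>p\<in>UNIV \<times> UNIV. G (N, p)) = (if N = 0 then (if l = n then a powi (- l) else 0) else 0)"
      unfolding euler_conv by auto
  qed
  also have "\<dots> = (\<Sum>\<^sub>\<infinity>N\<in>{0::int}. if l = n then a powi (- l) else 0)"
    by (rule infsum_cong_neutral) auto
  finally show ?thesis by simp
qed


section \<open>Inversion on the lattice and its double summability\<close>

text \<open>Exchanging the sums over \<open>m\<close> and \<open>n\<close> brings the orthogonality
  relation inside. Double summability is kept as a hypothesis because it is obtained differently for
  p = 1 and p > 1.\<close>

lemma bessel_seq_inversion_core:
  fixes g :: "int \<Rightarrow> real"
  assumes a: "0 < a" "a < 1"
    and double: "(\<lambda>(m, n). a powi m * bessel_seq Q a (l + m) * (g n * bessel_seq Q a (m + n)))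
      summable_on UNIV \<times> UNIV"
  shows "(\<lambda>m. a powi m * (\<Sum>\<^sub>\<infinity>n. g n * bessel_seq Q a (m + n)) * bessel_seq Q a (l + m)) summable_on UNIV"
    and "(\<Sum>\<^sub>\<infinity>m. a powi m * (\<Sum>\<^sub>\<infinity>n. g n * bessel_seq Q a (m + n)) * bessel_seq Q a (l + m)) = a powi (- l) * g l"
proof -
  have eq: "(\<Sum>\<^sub>\<infinity>n. a powi m * bessel_seq Q a (l + m) * (g n * bessel_seq Q a (m + n)))
      = a powi m * (\<Sum>\<^sub>\<infinity>n. g n * bessel_seq Q a (m + n)) * bessel_seq Q a (l + m)" for m
    by (simp add: infsum_cmult_right')
  show "(\<lambda>m. a powi m * (\<Sum>\<^sub>\<infinity>n. g n * bessel_seq Q a (m + n)) * bessel_seq Q a (l + m)) summable_on UNIV"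
    using summable_on_Sigma_banach[of "\<lambda>m n. a powi m * bessel_seq Q a (l + m) * (g n * bessel_seq Q a (m + n))" UNIV "\<lambda>_. UNIV"]
      double unfolding eq by simp
  have "(\<Sum>\<^sub>\<infinity>m. a powi m * (\<Sum>\<^sub>\<infinity>n. g n * bessel_seq Q a (m + n)) * bessel_seq Q a (l + m))
      = (\<Sum>\<^sub>\<infinity>n. \<Sum>\<^sub>\<infinity>m. a powi m * bessel_seq Q a (l + m) * (g n * bessel_seq Q a (m + n)))"
    unfolding eq[symmetric] by (rule infsum_swap_banach[OF double])
  also have "\<dots> = (\<Sum>\<^sub>\<infinity>n. g n * (\<Sum>\<^sub>\<infinity>m. a powi m * (bessel_seq Q a (l + m) * bessel_seq Q a (n + m))))"
    by (subst infsum_cmult_right'[symmetric]) (simp add: mult_ac add.commute)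
  also have "\<dots> = (\<Sum>\<^sub>\<infinity>n. g n * (if l = n then a powi (- l) else 0))"
    using bessel_seq_orthogonal[OF a] by simp
  also have "\<dots> = (\<Sum>\<^sub>\<infinity>n\<in>{l}. g n * a powi (- l))"
    by (rule infsum_cong_neutral) auto
  finally show "(\<Sum>\<^sub>\<infinity>m. a powi m * (\<Sum>\<^sub>\<infinity>n. g n * bessel_seq Q a (m + n)) * bessel_seq Q a (l + m)) = a powi (- l) * g l"
    by (simp add: mult.commute)
qed

text \<open>The situation of p = 1: boundedness of the Bessel sequence controls the sum over
  \<open>n\<close>, and \<open>a < 1\<close> controls the sum over \<open>m\<close>.\<close>

lemma
  fixes g :: "int \<Rightarrow> real"
  assumes a: "0 < a" "a < 1" and g: "g summable_on UNIV"
  shows summable_on_bessel_seq_of_summable: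
      "(\<lambda>n. g n * bessel_seq Q a (m + n)) summable_on UNIV"
    and double_summable_on_bessel_seq_of_summable:
      "(\<lambda>(m, n). a powi m * bessel_seq Q a (l + m) * (g n * bessel_seq Q a (m + n))) summable_on UNIV \<times> UNIV"
proof -
  obtain B where B: "\<bar>bessel_seq Q a k\<bar> \<le> B" for k
    using bessel_seq_bounded by blast
  have gB: "(\<lambda>n. \<bar>g n\<bar> * B) summable_on UNIV"
    by (intro summable_on_cmult_left summable_on_real_abs g)
  have le: "\<bar>g n * bessel_seq Q a k\<bar> \<le> \<bar>g n\<bar> * B" for n k
    unfolding abs_mult by (intro mult_left_mono B) simp
  show "(\<lambda>n. g n * bessel_seq Q a (m + n)) summable_on UNIV"
    by (rule summable_on_real_bound[OF gB le])
  show "(\<lambda>(m, n). a powi m * bessel_seq Q a (l + m) * (g n * bessel_seq Q a (m + n))) summable_on UNIV \<times> UNIV"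
  proof (rule summable_on_real_bound[OF summable_on_mult_Times[OF summable_on_bessel_seq_shift[OF a, of a l] gB]], clarify)
    fix m n
    show "\<bar>a powi m * bessel_seq Q a (l + m) * (g n * bessel_seq Q a (m + n))\<bar>
      \<le> a powi m * \<bar>bessel_seq Q a (l + m)\<bar> * (\<bar>g n\<bar> * B)"
      unfolding abs_mult[of "a powi m * _"] using a
      by (intro mult_mono le) (auto simp: abs_mult)
  qed
qed

text \<open>The situation of p > 1. With \<open>k = m + n\<close> the bound \<open>b powi n\<close>
  becomes \<open>b powi k * b powi (- m)\<close>, and the majorant factors into Bessel sums with
  bases \<open>a / b\<close> and \<open>b\<close>; hence the condition
  \<open>a < b < 1\<close>.\<close>

lemma
  fixes g :: "int \<Rightarrow> real"
  assumes a: "0 < a" "a < b" "b < 1" and g: "\<And>n. \<bar>g n\<bar> \<le> M * b powi n"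
  shows summable_on_bessel_seq_of_bound:
      "(\<lambda>n. g n * bessel_seq Q a (m + n)) summable_on UNIV"
    and double_summable_on_bessel_seq_of_bound:
      "(\<lambda>(m, n). a powi m * bessel_seq Q a (l + m) * (g n * bessel_seq Q a (m + n))) summable_on UNIV \<times> UNIV"
proof -
  have b: "0 < b" and ab: "0 < a / b" "a / b < 1" using a by auto
  have le: "\<bar>g n * bessel_seq Q a k\<bar> \<le> M * (b powi n * \<bar>bessel_seq Q a k\<bar>)" for n k
    using mult_right_mono[OF g[of n], of "\<bar>bessel_seq Q a k\<bar>"] by (simp add: abs_mult)
  show "(\<lambda>n. g n * bessel_seq Q a (m + n)) summable_on UNIV"
    by (rule summable_on_real_bound[OF _ le])
      (intro summable_on_cmult_right summable_on_bessel_seq_shift b \<open>b < 1\<close>)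
  define S where "S = (\<lambda>(m, k). ((a / b) powi m * \<bar>bessel_seq Q a (l + m)\<bar>) * (M * (b powi k * \<bar>bessel_seq Q a k\<bar>)))"
  have bij: "bij_betw (\<lambda>(m, n). (m, m + n)) (UNIV \<times> UNIV) (UNIV \<times> UNIV :: (int \<times> int) set)"
    by (rule bij_betw_byWitness[of _ "\<lambda>(m, k). (m, k - m)"]) auto
  have "S summable_on UNIV \<times> UNIV"
    unfolding S_def
    by (intro summable_on_mult_Times summable_on_cmult_right summable_on_bessel_seq_shift
        summable_on_bessel_seq b \<open>b < 1\<close> ab)
  then have "(\<lambda>z. S ((\<lambda>(m, n). (m, m + n)) z)) summable_on UNIV \<times> UNIV"
    by (simp only: summable_on_reindex_bij_betw[OF bij])
  then show "(\<lambda>(m, n). a powi m * bessel_seq Q a (l + m) * (g n * bessel_seq Q a (m + n))) summable_on UNIV \<times> UNIV"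
  proof (rule summable_on_real_bound, clarify)
    fix m n
    have "\<bar>a powi m * bessel_seq Q a (l + m) * (g n * bessel_seq Q a (m + n))\<bar>
        \<le> a powi m * \<bar>bessel_seq Q a (l + m)\<bar> * (M * (b powi n * \<bar>bessel_seq Q a (m + n)\<bar>))"
      unfolding abs_mult[of "a powi m * _"] using a
      by (intro mult_mono le) (auto simp: abs_mult)
    also have "\<dots> = S (m, m + n)"
      using b by (simp add: S_def power_int_divide_distrib power_int_add field_simps)
    finally show "\<bar>a powi m * bessel_seq Q a (l + m) * (g n * bessel_seq Q a (m + n))\<bar> \<le> S (m, m + n)" .
  qed
qed

section \<open>From the Bessel sequence to the q-Bessel function\<close>

text \<open>For \<open>k < 0\<close> the numerator contains a vanishing factor.\<close>
lemma inv_q_poch_eq: "inv_q_poch Q k = q_poch_inf (Q powi (k + 1)) Q / q_poch_inf Q Q"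
proof (cases "k < 0")
  case True
  \<comment> \<open>Chosen so that \<open>Q powi (k + 1) * Q ^ n = 1\<close>: the factor with index
    \<open>n\<close> is the one that vanishes.\<close>
  define n where "n = nat (- k - 1)"
  have "Q powi (k + 1) = inverse (Q ^ n)"
    using True by (simp add: n_def power_int_def power_inverse)
  then have "q_poch (Q powi (k + 1)) Q (Suc n) = 0"
    using Q_pos by (simp add: q_poch_Suc)
  then show ?thesis
    using True q_poch_inf_split[of "Q powi (k + 1)" "Suc n"] by simp
next
  case False
  then have "Q powi (k + 1) = Q * Q ^ nat k"
    using Q_pos by (simp add: power_int_add) (simp add: power_int_def)
  then show ?thesis
    using False q_poch_inf_split[of Q "nat k"] q_poch_pos[of "nat k"] q_poch_inf_pos
    by (simp add: inv_q_poch_def frac_eq_eq zero_less_mult_iff)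
qed

text \<open>Both sides sum the same array \<open>X\<close>. Euler's series in \<open>i\<close>
  produces \<open>q_poch_inf (a * Q ^ n) Q\<close>; Euler's series in \<open>n\<close> produces
  \<open>inv_q_poch Q (i + k)\<close> through \<open>inv_q_poch_eq\<close>.\<close>

lemma bessel_seq_sums:
  assumes a: "0 < a" "a < 1"
  shows "(\<lambda>n. euler_coeff Q (int n) * (Q powi (k + 1)) ^ n * q_poch_inf (a * Q ^ n) Q / q_poch_inf Q Q)
    sums bessel_seq Q a k"
proof -
  define P where "P = q_poch_inf Q Q"
  define y where "y = Q powi (k + 1)"
  define X where "X n i = (euler_coeff Q (int n) * y ^ n / P) * (euler_coeff Q i * (a * Q ^ n) powi i)" for n i
  have P: "P > 0" using q_poch_inf_pos by (simp add: P_def)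
  have y: "y > 0" using Q_pos by (simp add: y_def)
  have X_alt: "X n i = (euler_coeff Q i * a powi i / P) * (euler_coeff Q (int n) * (Q powi (i + k + 1)) ^ n)" for n i
  proof -
    have "(Q powi (i + k + 1)) ^ n = y ^ n * (Q ^ n) powi i"
      using Q_pos power_int_power[of Q n i] power_int_power'[of Q i n]
      by (simp add: y_def power_int_add power_mult_distrib mult_ac)
    then show ?thesis by (simp add: X_def power_int_mult_distrib)
  qed
  have row: "((\<lambda>i. X n i) has_sum (euler_coeff Q (int n) * y ^ n * q_poch_inf (a * Q ^ n) Q / P)) UNIV" for n
    using has_sum_cmult_right[OF euler_has_sum[of "a * Q ^ n"], of "euler_coeff Q (int n) * y ^ n / P"]
    by (simp add: X_def)
  have col: "((\<lambda>n. X n i) has_sum (euler_coeff Q i * a powi i * inv_q_poch Q (i + k))) UNIV" for i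
    using has_sum_cmult_right[OF euler_has_sum_nat[of "Q powi (i + k + 1)"], of "euler_coeff Q i * a powi i / P"]
    by (simp add: X_alt inv_q_poch_eq P_def)
  have n_sum: "(\<lambda>n. \<bar>euler_coeff Q (int n) * y ^ n\<bar> * (1 / P)) summable_on UNIV"
    using norm_summable_imp_summable_on[of "\<lambda>n. \<bar>euler_coeff Q (int n) * y ^ n\<bar>"] summable_euler_coeff[of y]
    by (intro summable_on_cmult_left) simp
  have X: "(\<lambda>(n, i). X n i) summable_on UNIV \<times> UNIV"
  proof (rule summable_on_real_bound[OF summable_on_mult_Times[OF n_sum summable_on_euler_coeff[of a]]], clarify)
    fix n :: nat and i :: int
    \<comment> \<open>Dropping \<open>Q ^ n\<close> from the base decouples \<open>n\<close> from
      \<open>i\<close>. This is a majorization for \<open>i \<ge> 0\<close>, and for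
      \<open>i < 0\<close> the coefficient is 0.\<close>
    have "\<bar>euler_coeff Q i * (a * Q ^ n) powi i\<bar> \<le> \<bar>euler_coeff Q i\<bar> * \<bar>a powi i\<bar>"
    proof (cases "i < 0")
      case False
      have "(a * Q ^ n) powi i \<le> a powi i"
        using False a Q_pos Q_less_1 by (auto simp: power_int_def power_le_one mult_left_le intro!: power_mono)
      moreover have "(a * Q ^ n) powi i \<ge> 0" using a Q_pos by simp
      ultimately show ?thesis using a by (simp add: abs_mult mult_left_mono)
    qed simp
    then have "\<bar>euler_coeff Q (int n) * y ^ n\<bar> * (1 / P) * \<bar>euler_coeff Q i * (a * Q ^ n) powi i\<bar>
        \<le> \<bar>euler_coeff Q (int n) * y ^ n\<bar> * (1 / P) * (\<bar>euler_coeff Q i\<bar> * \<bar>a powi i\<bar>)"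
      using P by (intro mult_left_mono) auto
    then show "\<bar>X n i\<bar> \<le> \<bar>euler_coeff Q (int n) * y ^ n\<bar> * (1 / P) * (\<bar>euler_coeff Q i\<bar> * \<bar>a powi i\<bar>)"
      using P by (simp add: X_def abs_mult)
  qed
  have "(\<lambda>n. \<Sum>\<^sub>\<infinity>i. X n i) summable_on UNIV"
    using summable_on_Sigma_banach[of X UNIV "\<lambda>_. UNIV"] X by simp
  then have "(\<lambda>n. \<Sum>\<^sub>\<infinity>i. X n i) sums (\<Sum>\<^sub>\<infinity>n. \<Sum>\<^sub>\<infinity>i. X n i)"
    by (intro has_sum_imp_sums has_sum_infsum)
  moreover have "(\<Sum>\<^sub>\<infinity>n. \<Sum>\<^sub>\<infinity>i. X n i) = bessel_seq Q a k"
    unfolding infsum_swap_banach[OF X] bessel_seq_def infsumI[OF col] ..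
  ultimately show ?thesis by (simp only: infsumI[OF row] y_def P_def)
qed

end

text \<open>The quotient (a; Q)_inf / (a; Q)_n is (a Q^n; Q)_inf, and n (n + 1) = 2 (n choose 2) + 2
  n turns the power of \<open>q\<close> into that of an Euler coefficient times
  \<open>Q ^ n\<close>. This matches the series of \<open>bessel_seq_sums\<close> term by
  term.\<close>

lemma q_bessel_eq_bessel_seq:
  assumes q: "0 < q" "q < 1" and \<nu>: "\<nu> > -1"
  defines "a \<equiv> q powr (2 * \<nu> + 2)"
  shows "q_poch_inf a (q\<^sup>2) / q_poch_inf (q\<^sup>2) (q\<^sup>2) * q_bessel q \<nu> (q powi k) = bessel_seq (q\<^sup>2) a k"
proof -
  interpret q_base "q\<^sup>2"
    by unfold_locales (use q in \<open>auto simp: power_less_one_iff\<close>)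
  have a: "0 < a" "a < 1"
    using q \<nu> by (auto simp: a_def powr01_less_one)
  define K where "K = q_poch_inf a (q\<^sup>2) / q_poch_inf (q\<^sup>2) (q\<^sup>2)"
  have K: "K > 0"
    using q_poch_inf_pos q_poch_inf_pos_of_less_1[OF a] by (simp add: K_def)
  define t where "t n = (- 1) ^ n * (q ^ (n * (n + 1)) / (q_poch a (q\<^sup>2) n * q_poch (q\<^sup>2) (q\<^sup>2) n)) * (q powi k) ^ (2 * n)" for n
  have "euler_coeff (q\<^sup>2) (int n) * ((q\<^sup>2) powi (k + 1)) ^ n * q_poch_inf (a * (q\<^sup>2) ^ n) (q\<^sup>2) / q_poch_inf (q\<^sup>2) (q\<^sup>2) = K * t n" for n
  proof -
    have "2 * (n choose 2) + 2 * n = n * (n + 1)"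
      by (induction n) (auto simp: numeral_2_eq_2)
    then have "q ^ (n * (n + 1)) = (q\<^sup>2) ^ (n choose 2) * (q\<^sup>2) ^ n"
      by (metis power_add power_mult)
    moreover have "((q\<^sup>2) powi (k + 1)) ^ n = (q\<^sup>2) ^ n * (q powi k) ^ (2 * n)"
      using q power_int_power[of q 2 k] power_int_power'[of q k 2]
      unfolding power_mult by (simp add: power_int_add power_mult_distrib mult.commute)
    moreover have "q_poch_inf a (q\<^sup>2) = q_poch a (q\<^sup>2) n * q_poch_inf (a * (q\<^sup>2) ^ n) (q\<^sup>2)"
      by (rule q_poch_inf_split)
    ultimately show ?thesis
      using q_poch_pos[of n] q_poch_pos_of_less_1[OF a, of n]
      by (simp add: K_def t_def euler_coeff_def field_simps)
  qed
  then have "(\<lambda>n. K * t n) sums bessel_seq (q\<^sup>2) a k"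
    using bessel_seq_sums[OF a, of k] by simp
  then have "t sums (bessel_seq (q\<^sup>2) a k / K)"
    using sums_divide[of "\<lambda>n. K * t n" _ K] K by simp
  then have "q_bessel q \<nu> (q powi k) = bessel_seq (q\<^sup>2) a k / K"
    unfolding q_bessel_def a_def[symmetric] t_def by (rule sums_unique[symmetric])
  then show ?thesis using K by (simp flip: K_def)
qed

section \<open>The transform in lattice coordinates\<close>

lemma jackson_weight:
  fixes q \<nu> :: real
  assumes "0 < q"
  shows "q powi n * (q powi n) powr (2 * \<nu> + 1) = (q powr (2 * \<nu> + 2)) powi n"
proof -
  have "q powi n * (q powi n) powr (2 * \<nu> + 1) = (q powi n) powr (1 + (2 * \<nu> + 1))"
    using assms by (subst powr_add) simp
  also have "\<dots> = (q powr (2 * \<nu> + 2)) powi n"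
    using assms by (simp add: powr_powr mult.commute add_ac flip: powr_real_of_int')
  finally show ?thesis .
qed

text \<open>On the lattice the product of the arguments becomes the sum of the exponents, so the
  kernel depends on \<open>m + n\<close> only; the normalizing constant is absorbed into
  \<open>bessel_seq\<close>.\<close>

lemma q_fourier_integrand_eq:
  assumes q: "0 < q" "q < 1" and \<nu>: "\<nu> > -1"
  defines "a \<equiv> q powr (2 * \<nu> + 2)"
  shows "q_bessel_const q \<nu> * (1 - q) * (q powi n * q_fourier_integrand q \<nu> f (q powi m) (q powi n))
    = a powi n * f (q powi n) * bessel_seq (q\<^sup>2) a (m + n)"
proof -
  have "q powi n * (q powi n) powr (2 * \<nu> + 1) = a powi n"
    unfolding a_def by (rule jackson_weight[OF q(1)])
  moreover have "q powi m * q powi n = q powi (m + n)"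
    using q by (simp add: power_int_add)
  moreover have "q_bessel_const q \<nu> * (1 - q) * q_bessel q \<nu> (q powi (m + n)) = bessel_seq (q\<^sup>2) a (m + n)"
    using q_bessel_eq_bessel_seq[OF q \<nu>, of "m + n"] q by (simp add: q_bessel_const_def a_def)
  moreover have "q_bessel_const q \<nu> * (1 - q) * (q powi n * q_fourier_integrand q \<nu> f (q powi m) (q powi n))
      = (q powi n * (q powi n) powr (2 * \<nu> + 1)) * f (q powi n)
        * (q_bessel_const q \<nu> * (1 - q) * q_bessel q \<nu> (q powi m * q powi n))"
    unfolding q_fourier_integrand_def by (simp only: mult_ac)
  ultimately show ?thesis by (simp only:)
qed

text \<open>Since the constant is nonzero, summability of the scaled terms is equivalent to
  existence of the transform.\<close>

lemma q_bessel_const_pos: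
  assumes q: "0 < q" "q < 1" and \<nu>: "\<nu> > -1"
  shows "q_bessel_const q \<nu> > 0"
proof -
  interpret q_base "q\<^sup>2"
    by unfold_locales (use q in \<open>auto simp: power_less_one_iff\<close>)
  show ?thesis
    using q \<nu> q_poch_inf_pos q_poch_inf_pos_of_less_1[of "q powr (2 * \<nu> + 2)"]
    by (simp add: q_bessel_const_def powr01_less_one)
qed

lemma q_fourier_eq:
  assumes q: "0 < q" "q < 1" and \<nu>: "\<nu> > -1"
  defines "a \<equiv> q powr (2 * \<nu> + 2)"
  shows "q_fourier q \<nu> f (q powi m) = (\<Sum>\<^sub>\<infinity>n. a powi n * f (q powi n) * bessel_seq (q\<^sup>2) a (m + n))"
    and "q_fourier_exists q \<nu> f (q powi m) \<longleftrightarrow>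
      (\<lambda>n. a powi n * f (q powi n) * bessel_seq (q\<^sup>2) a (m + n)) summable_on UNIV"
proof -
  note eq = q_fourier_integrand_eq[OF q \<nu>, folded a_def, symmetric]
  have "q_bessel_const q \<nu> * (1 - q) \<noteq> 0"
    using q_bessel_const_pos[OF q \<nu>] q by simp
  then show "q_fourier_exists q \<nu> f (q powi m) \<longleftrightarrow>
      (\<lambda>n. a powi n * f (q powi n) * bessel_seq (q\<^sup>2) a (m + n)) summable_on UNIV"
    unfolding q_fourier_exists_def jackson_integrable_def eq
    by (subst summable_on_cmult_right') auto
  show "q_fourier q \<nu> f (q powi m) = (\<Sum>\<^sub>\<infinity>n. a powi n * f (q powi n) * bessel_seq (q\<^sup>2) a (m + n))"
    unfolding q_fourier_def jackson_integral_def eq by (simp add: infsum_cmult_right')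
qed

section \<open>Bounds from membership in \<open>Lq_space\<close>, and the inversion formula\<close>

lemma Lq_space_summable:
  assumes q: "0 < q" and f: "f \<in> Lq_space q p \<nu>"
  defines "a \<equiv> q powr (2 * \<nu> + 2)"
  shows "(\<lambda>n. a powi n * \<bar>f (q powi n)\<bar> powr p) summable_on UNIV"
proof -
  have "q powi n * (\<bar>f (q powi n)\<bar> powr p * (q powi n) powr (2 * \<nu> + 1)) = a powi n * \<bar>f (q powi n)\<bar> powr p" for n
    using jackson_weight[OF q, of n \<nu>, folded a_def] by (metis mult.assoc mult.commute)
  then show ?thesis
    using f unfolding Lq_space_def jackson_integrable_def mem_Collect_eq by (simp only:)
qed

text \<open>Each term of a convergent nonnegative series is at most its sum S. Taking p-th roots of
  \<open>a powi n * \<bar>f (q powi n)\<bar> powr p \<le> S\<close> leaves the power 1 - 1/p of the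
  weight.\<close>

lemma Lq_space_bound:
  assumes q: "0 < q" and p: "p \<ge> 1" and f: "f \<in> Lq_space q p \<nu>"
  defines "a \<equiv> q powr (2 * \<nu> + 2)"
  shows "\<exists>M. \<forall>n. \<bar>a powi n * f (q powi n)\<bar> \<le> M * (a powr (1 - 1 / p)) powi n"
proof (intro exI allI)
  fix n
  define F where "F n = a powi n * \<bar>f (q powi n)\<bar> powr p" for n
  have a: "a > 0" using q by (simp add: a_def)
  have F: "F summable_on UNIV" "F n \<ge> 0" for n
    using Lq_space_summable[OF q f, folded a_def] a unfolding F_def by simp_all
  have "F n = infsum F {n}" by simp
  also have "\<dots> \<le> infsum F UNIV"
    using F by (intro infsum_mono_neutral) auto
  finally have le: "F n \<le> infsum F UNIV" .
  \<comment> \<open>The exponent 1 is written as (1 - 1/p) + 1/p so that the second part of the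
    weight joins \<open>f\<close> to form \<open>F n powr (1 / p)\<close>.\<close>
  have "\<bar>a powi n * f (q powi n)\<bar> = (a powi n) powr (1 - 1 / p + 1 / p) * (\<bar>f (q powi n)\<bar> powr p) powr (1 / p)"
    using a p by (simp add: abs_mult powr_powr)
  also have "\<dots> = (a powi n) powr (1 - 1 / p) * F n powr (1 / p)"
    using a unfolding powr_add by (simp add: F_def powr_mult)
  also have "\<dots> \<le> (a powi n) powr (1 - 1 / p) * infsum F UNIV powr (1 / p)"
    using le F(2)[of n] p by (intro mult_left_mono powr_mono2) auto
  also have "(a powi n) powr (1 - 1 / p) = (a powr (1 - 1 / p)) powi n"
    using a by (simp add: powr_powr mult.commute flip: powr_real_of_int')
  finally show "\<bar>a powi n * f (q powi n)\<bar> \<le> infsum F UNIV powr (1 / p) * (a powr (1 - 1 / p)) powi n"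
    by (simp add: mult.commute)
qed

theorem theorem1:
  fixes q \<nu> p :: real and f :: "real \<Rightarrow> real"
  assumes "0 < q" and "q < 1" and "\<nu> > -1" and "p \<ge> 1"
    and "f \<in> Lq_space q p \<nu>"
  shows "\<forall>x\<in>Rq_plus q.
           q_fourier_exists q \<nu> f x \<and>
           q_fourier_exists q \<nu> (q_fourier q \<nu> f) x \<and>
           q_fourier q \<nu> (q_fourier q \<nu> f) x = f x"
proof -
  interpret q_base "q\<^sup>2"
    by unfold_locales (use assms in \<open>auto simp: power_less_one_iff\<close>)
  define a where "a = q powr (2 * \<nu> + 2)"
  define g where "g n = a powi n * f (q powi n)" for n
  have a: "0 < a" "a < 1"
    using assms by (auto simp: a_def powr01_less_one)
  note fourier = q_fourier_eq[OF assms(1-3), folded a_def]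
  have "(\<lambda>n. g n * bessel_seq (q\<^sup>2) a (m + n)) summable_on UNIV \<and>
      (\<lambda>(m, n). a powi m * bessel_seq (q\<^sup>2) a (l + m) * (g n * bessel_seq (q\<^sup>2) a (m + n))) summable_on UNIV \<times> UNIV" for l m
  \<comment> \<open>At p = 1 the base \<open>a powr (1 - 1 / p)\<close> would be 1, outside the
    range \<open>b < 1\<close> of the geometric bound; there \<open>g\<close> itself is
    summable.\<close>
  proof (cases "p = 1")
    case True
    have "g summable_on UNIV"
      by (rule summable_on_real_bound[OF Lq_space_summable[OF assms(1,5), folded a_def]])
        (use True a in \<open>simp add: g_def abs_mult\<close>)
    then show ?thesis
      using summable_on_bessel_seq_of_summable[OF a] double_summable_on_bessel_seq_of_summable[OF a] by blast
  next
    case False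
    with assms have p: "p > 1" by simp
    define b where "b = a powr (1 - 1 / p)"
    \<comment> \<open>For p > 1 the exponent lies strictly between 0 and 1, which places
      \<open>b\<close> strictly between \<open>a\<close> and 1.\<close>
    have "a powr 1 < b" unfolding b_def using a p by (intro powr_less_mono') auto
    moreover have "b < 1" unfolding b_def using a p by (subst powr01_less_one) auto
    moreover obtain M where "\<And>n. \<bar>g n\<bar> \<le> M * b powi n"
      using Lq_space_bound[OF assms(1,4,5)] by (auto simp: g_def b_def a_def)
    ultimately show ?thesis
      using summable_on_bessel_seq_of_bound[of a b g M] double_summable_on_bessel_seq_of_bound[of a b g M] a
      by simp
  qed
  then have conv: "(\<lambda>n. g n * bessel_seq (q\<^sup>2) a (m + n)) summable_on UNIV"
    and double: "(\<lambda>(m, n). a powi m * bessel_seq (q\<^sup>2) a (l + m) * (g n * bessel_seq (q\<^sup>2) a (m + n))) summable_on UNIV \<times> UNIV" for l m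
    by blast+
  show ?thesis
  proof
    fix x assume "x \<in> Rq_plus q"
    then obtain l where x: "x = q powi l" by (auto simp: Rq_plus_def)
    \<comment> \<open>The weight left over by orthogonality cancels the one built into
      \<open>g\<close>.\<close>
    have "a powi (- l) * g l = f x"
      using a by (simp add: g_def x power_int_minus)
    then show "q_fourier_exists q \<nu> f x \<and> q_fourier_exists q \<nu> (q_fourier q \<nu> f) x \<and>
        q_fourier q \<nu> (q_fourier q \<nu> f) x = f x"
      using conv[of l] bessel_seq_inversion_core[OF a double[of l]]
      unfolding x fourier g_def by simp
  qed
qed

end
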